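(* The $28$ bitangents to the Dyck quartic curve intersect along $288$ double and $15$ quadruple points (and at no other points).
   Context: Work over $\mathbb{C}$. The Dyck quartic is the smooth plane curve in $\mathbb{P}^2_{\mathbb{C}}$ given by $x^4 + y^4 + z^4=0$. A bitangent of a smooth plane quartic is a line tangent to the curve at two points, which are allowed to coincide, i.e. the line cuts out a divisor $2P+2P'$ on the curve, with $P=P'$ allowed. A double (respectively quadruple) point of a line arrangement is a point lying on exactly two (respectively exactly four) of the lines. *)

theory Defs
  imports "HOL-Analysis.Analysis" "HOL-Computational_Algebra.Polynomial"
begin

text \<open>Points and lines of the complex projective plane are the linear subspaces of
  \<open>\<complex>\<^sup>3\<close> of dimension 1 and 2; incidence is inclusion. The prefix \<open>vec\<close> selects the
  complex linear structure, whereas the unqualified \<open>subspace\<close> and \<open>dim\<close> are real.\<close>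

definition proj_point :: "(complex ^ 3) set \<Rightarrow> bool" where
  "proj_point P \<longleftrightarrow> vec.subspace P \<and> vec.dim P = 1"

definition proj_line :: "(complex ^ 3) set \<Rightarrow> bool" where
  "proj_line L \<longleftrightarrow> vec.subspace L \<and> vec.dim L = 2"

definition plane_curve :: "(complex ^ 3 \<Rightarrow> complex) \<Rightarrow> (complex ^ 3) set set" where
  "plane_curve F = {P. proj_point P \<and> (\<forall>v\<in>P. F v = 0)}"

text \<open>The restriction of \<open>F\<close> to the line through \<open>[p]\<close> and \<open>[q]\<close> is, in the affine
  coordinate \<open>t\<close> centred at \<open>[p]\<close>, the polynomial \<open>F (p + t q)\<close>; for a form \<open>F\<close> its
  vanishing order at \<open>t = 0\<close> is the intersection multiplicity of the line with the curve
  \<open>F = 0\<close> at \<open>[p]\<close>. The condition \<open>g \<noteq> 0\<close> says that the line is not a component.\<close>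

definition meets_with_multiplicity ::
    "(complex ^ 3 \<Rightarrow> complex) \<Rightarrow> complex ^ 3 \<Rightarrow> complex ^ 3 \<Rightarrow> nat \<Rightarrow> bool" where
  "meets_with_multiplicity F p q m \<longleftrightarrow>
     (\<exists>g :: complex poly. (\<forall>t. poly g t = F (p + t *s q)) \<and> g \<noteq> 0 \<and> order 0 g = m)"

text \<open>An effective divisor is given by its multiplicity function on points. The
  multiplicity does not depend on the spanning vectors \<open>p\<close>, \<open>q\<close>, so quantifying over all of
  them is harmless.\<close>

definition cuts_out_divisor ::
    "(complex ^ 3 \<Rightarrow> complex) \<Rightarrow> (complex ^ 3) set \<Rightarrow> ((complex ^ 3) set \<Rightarrow> nat) \<Rightarrow> bool" where
  "cuts_out_divisor F L D \<longleftrightarrow>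
     (\<forall>p q. vec.span {p, q} = L \<longrightarrow> meets_with_multiplicity F p q (D (vec.span {p}))) \<and>
     (\<forall>R. proj_point R \<and> \<not> R \<subseteq> L \<longrightarrow> D R = 0)"

definition bitangent :: "(complex ^ 3 \<Rightarrow> complex) \<Rightarrow> (complex ^ 3) set \<Rightarrow> bool" where
  "bitangent F L \<longleftrightarrow> proj_line L \<and>
     (\<exists>P\<in>plane_curve F. \<exists>P'\<in>plane_curve F.
        cuts_out_divisor F L
          (\<lambda>R. 2 * (if R = P then 1 else 0) + 2 * (if R = P' then 1 else 0)))"

definition dyck_form :: "complex ^ 3 \<Rightarrow> complex" where
  "dyck_form v = (v $ 1) ^ 4 + (v $ 2) ^ 4 + (v $ 3) ^ 4"

definition multiple_point :: "(complex ^ 3) set set \<Rightarrow> nat \<Rightarrow> (complex ^ 3) set \<Rightarrow> bool" where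
  "multiple_point A k P \<longleftrightarrow>
     proj_point P \<and> finite {L \<in> A. P \<subseteq> L} \<and> card {L \<in> A. P \<subseteq> L} = k"

end

theory Submission
  imports Defs "HOL-Computational_Algebra.Fundamental_Theorem_Algebra"
begin

text \<open>The restriction of a form to a bitangent has even order at every point, hence is the square
  of a polynomial. Parametrising the line by two of the coordinates and comparing coefficients
  forces its equation to be \<open>x + u y = 0\<close>, \<open>x + u z = 0\<close> or \<open>y + u z = 0\<close> with \<open>u\<^sup>4 = -1\<close>
  (hyperflexes, where the form restricts to a fourth power), or \<open>x + a y + b z = 0\<close> with
  \<open>a\<^sup>4 = b\<^sup>4 = 1\<close>, where \<open>(Y + Z)\<^sup>4 + Y\<^sup>4 + Z\<^sup>4 = 2 (Y\<^sup>2 + Y Z + Z\<^sup>2)\<^sup>2\<close> for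
  \<open>Y = a y\<close>, \<open>Z = b z\<close>. On the coordinate triangle a point lies on 0, 1 or 4 of these lines, and
  on 4 exactly at the 3 vertices and the 12 points with nonzero coordinates \<open>1, u\<close>, \<open>u\<^sup>4 = 1\<close>; off
  the triangle it lies on at most 2. Counting ordered pairs of distinct lines by their
  intersection point, \<open>28 * 27 = 4 * 3 * 15 + 2 * d\<close>, gives the number \<open>d = 288\<close> of double
  points.\<close>

section \<open>Points and lines of the plane through coordinate vectors and normals\<close>

definition dot3 :: "complex ^ 3 \<Rightarrow> complex ^ 3 \<Rightarrow> complex" where
  "dot3 n v = n $ 1 * v $ 1 + n $ 2 * v $ 2 + n $ 3 * v $ 3"

definition line_of :: "complex ^ 3 \<Rightarrow> (complex ^ 3) set" where
  "line_of n = {v. dot3 n v = 0}"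

text \<open>Each point and each line has exactly one representative, respectively normal vector, whose
  first nonzero coordinate is 1.\<close>

definition normed :: "complex ^ 3 \<Rightarrow> bool" where
  "normed v \<longleftrightarrow> v $ 1 = 1 \<or> v $ 1 = 0 \<and> v $ 2 = 1 \<or> v $ 1 = 0 \<and> v $ 2 = 0 \<and> v $ 3 = 1"

lemma vec3_eq_iff: "v = w \<longleftrightarrow> v $ 1 = w $ 1 \<and> v $ 2 = w $ 2 \<and> v $ 3 = w $ 3"
  for v w :: "complex ^ 3"
  by (simp add: vec_eq_iff forall_3)

lemma dot3_add: "dot3 n (v + w) = dot3 n v + dot3 n w"
  by (simp add: dot3_def algebra_simps)

lemma dot3_diff: "dot3 n (v - w) = dot3 n v - dot3 n w"
  by (simp add: dot3_def algebra_simps)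

lemma dot3_scale: "dot3 n (c *s v) = c * dot3 n v"
  by (simp add: dot3_def algebra_simps)

lemma normed_exists:
  assumes "v \<noteq> 0"
  obtains c w where "c \<noteq> 0" "normed w" "v = c *s w"
proof (cases "v $ 1 = 0 \<and> v $ 2 = 0")
  case True
  then show ?thesis
    using assms that[of "v $ 3" "vector [0, 0, 1]"] by (auto simp: vec3_eq_iff normed_def)
next
  case False
  show ?thesis
  proof (cases "v $ 1 = 0")
    case True
    then show ?thesis
      using False that[of "v $ 2" "vector [0, 1, v $ 3 / v $ 2]"]
      by (auto simp: vec3_eq_iff normed_def)
  next
    case False
    then show ?thesis
      using that[of "v $ 1" "vector [1, v $ 2 / v $ 1, v $ 3 / v $ 1]"]
      by (auto simp: vec3_eq_iff normed_def)
  qed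
qed

lemma normed_nonzero: "normed v \<Longrightarrow> v \<noteq> 0"
  by (auto simp: normed_def vec3_eq_iff)

text \<open>The vanishing of the cross product: proportionality without naming a scalar, as
  polynomial equations between coordinates.\<close>

definition parallel :: "complex ^ 3 \<Rightarrow> complex ^ 3 \<Rightarrow> bool" where
  "parallel v w \<longleftrightarrow> v $ 1 * w $ 2 = v $ 2 * w $ 1 \<and> v $ 1 * w $ 3 = v $ 3 * w $ 1
     \<and> v $ 2 * w $ 3 = v $ 3 * w $ 2"

lemma normed_parallel_eq: "normed v \<Longrightarrow> normed w \<Longrightarrow> parallel v w \<Longrightarrow> v = w"
  unfolding normed_def parallel_def vec3_eq_iff by (elim disjE) auto

lemma span_eq_parallel:
  assumes "vec.span {v} = vec.span {w}"
  shows "parallel v w"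
proof -
  have "v \<in> vec.span {w}"
    using assms by (metis singletonI vec.span_base)
  then obtain k where "v = k *s w"
    by (auto simp: vec.span_singleton)
  then show ?thesis
    by (simp add: parallel_def)
qed

text \<open>Up to sign, the vectors used below are the cross products of \<open>v\<close> with the
  standard basis, so they lie on its line; testing them against \<open>w\<close> gives the three
  equations of \<open>parallel\<close>.\<close>

lemma line_of_eq_parallel:
  assumes "line_of v = line_of w"
  shows "parallel v w"
proof -
  have "vector [v $ 2, - v $ 1, 0] \<in> line_of w" "vector [v $ 3, 0, - v $ 1] \<in> line_of w"
      "vector [0, v $ 3, - v $ 2] \<in> line_of w"
    unfolding assms[symmetric] by (auto simp: line_of_def dot3_def)
  then show ?thesis
    by (simp add: line_of_def dot3_def parallel_def mult.commute)
qed

lemma line_of_scale: "c \<noteq> 0 \<Longrightarrow> line_of (c *s n) = line_of n"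
  by (simp add: line_of_def dot3_def mult.assoc flip: distrib_left)

lemma span_scale: "c \<noteq> 0 \<Longrightarrow> vec.span {c *s v} = vec.span {v}" for v :: "complex ^ 3"
  using vec.span_image_scale[of "{v}" "\<lambda>_. c"] by simp

lemma proj_point_span: "v \<noteq> 0 \<Longrightarrow> proj_point (vec.span {v})"
  by (simp add: proj_point_def)

lemma proj_point_obtain:
  assumes "proj_point P"
  obtains v where "normed v" "P = vec.span {v}"
proof -
  obtain B where B: "B \<subseteq> P" "vec.independent B" "P \<subseteq> vec.span B" "card B = 1"
    using assms vec.basis_exists[of P] unfolding proj_point_def by metis
  then obtain v where v: "B = {v}"
    by (auto simp: card_1_singleton_iff)
  then have "v \<noteq> 0" "P = vec.span {v}"
    using B assms by (auto simp: proj_point_def intro: subsetD[OF vec.span_minimal])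
  then show ?thesis
    using that normed_exists span_scale by metis
qed

lemma subspace_line_of: "vec.subspace (line_of n)"
  by (auto simp: vec.subspace_def line_of_def dot3_add dot3_scale) (simp add: dot3_def)

text \<open>The kernel of a nonzero linear form has codimension one: together with any vector
  \<open>w\<close> off the kernel it spans the whole space.\<close>

lemma proj_line_line_of:
  assumes "n \<noteq> 0"
  shows "proj_line (line_of n)"
proof -
  obtain w where w: "dot3 n w \<noteq> 0"
  proof -
    have "dot3 n (axis i 1) = n $ i" for i
      using exhaust_3[of i] by (auto simp: dot3_def axis_def)
    then show ?thesis
      using that assms by (metis vec_eq_iff zero_index)
  qed
  have "v \<in> vec.span (insert w (line_of n))" for v
  proof -
    have "v - (dot3 n v / dot3 n w) *s w \<in> line_of n"
      using w by (simp add: line_of_def dot3_diff dot3_scale)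
    then show ?thesis
      unfolding vec.span_breakdown_eq using vec.span_base by blast
  qed
  then have "vec.span (insert w (line_of n)) = UNIV"
    by blast
  then have "vec.dim (insert w (line_of n)) = 3"
    using vec_dim_card[where 'a = complex and 'n = 3] by (simp flip: vec.dim_span[of "insert w (line_of n)"])
  moreover have "w \<notin> vec.span (line_of n)"
    using w subspace_line_of by (auto simp: vec.span_eq_iff[THEN iffD2] line_of_def)
  ultimately show ?thesis
    using subspace_line_of by (simp add: proj_line_def vec.dim_insert)
qed

lemma proj_lines_subset_eq: "proj_line L \<Longrightarrow> proj_line M \<Longrightarrow> L \<subseteq> M \<Longrightarrow> L = M"
  unfolding proj_line_def by (intro vec.subspace_dim_equal) auto

lemma proj_points_subset_eq: "proj_point L \<Longrightarrow> proj_point M \<Longrightarrow> L \<subseteq> M \<Longrightarrow> L = M"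
  unfolding proj_point_def by (intro vec.subspace_dim_equal) auto

lemma proj_line_obtain:
  assumes "proj_line L"
  obtains n where "normed n" "L = line_of n"
proof -
  obtain B where B: "B \<subseteq> L" "vec.independent B" "L \<subseteq> vec.span B" "card B = 2"
    using assms vec.basis_exists[of L] unfolding proj_line_def by metis
  then obtain p q where pq: "B = {p, q}" "p \<noteq> q"
    by (auto simp: card_2_iff)
  have indep: "q \<noteq> 0" "p \<notin> vec.span {q}"
    using B(2) pq by (auto simp: vec.independent_insert)
  \<comment> \<open>The cross product of the basis vectors: it annihilates both, and it is nonzero
    because they are independent.\<close>
  define n :: "complex ^ 3" where
    "n = vector [p $ 2 * q $ 3 - p $ 3 * q $ 2, p $ 3 * q $ 1 - p $ 1 * q $ 3,
                 p $ 1 * q $ 2 - p $ 2 * q $ 1]"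
  have "n \<noteq> 0"
  proof
    assume "n = 0"
    then have n: "p $ 2 * q $ 3 = p $ 3 * q $ 2" "p $ 3 * q $ 1 = p $ 1 * q $ 3"
        "p $ 1 * q $ 2 = p $ 2 * q $ 1"
      by (auto simp: n_def vec3_eq_iff)
    obtain i where i: "q $ i \<noteq> 0"
      using indep by (metis vec_eq_iff zero_index)
    have "p = (p $ i / q $ i) *s q"
      using exhaust_3[of i] i n by (auto simp: vec3_eq_iff field_simps)
    then show False
      using indep(2) by (metis vec.span_base vec.span_scale singletonI)
  qed
  have "{p, q} \<subseteq> line_of n"
    by (auto simp: line_of_def dot3_def n_def algebra_simps)
  then have "L \<subseteq> line_of n"
    using B(3) pq vec.span_minimal[OF _ subspace_line_of] by blast
  then have "L = line_of n"
    using proj_lines_subset_eq assms proj_line_line_of \<open>n \<noteq> 0\<close> by blast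
  then show ?thesis
    using that normed_exists \<open>n \<noteq> 0\<close> line_of_scale by metis
qed

text \<open>The sum of two distinct 2-dimensional subspaces properly contains each of them, so it
  has dimension 3, which leaves 2 + 2 - 3 = 1 for the intersection.\<close>

lemma proj_point_Int:
  assumes "proj_line L" "proj_line M" "L \<noteq> M"
  shows "proj_point (L \<inter> M)"
proof -
  let ?S = "{x + y |x y. x \<in> L \<and> y \<in> M}"
  have sub: "vec.subspace L" "vec.subspace M" "vec.dim L = 2" "vec.dim M = 2"
    using assms by (auto simp: proj_line_def)
  have S: "vec.subspace ?S"
    using sub vec.subspace_sums by blast
  have LS: "L \<subseteq> ?S"
    using vec.subspace_0[OF sub(2)] by force
  have MS: "M \<subseteq> ?S"
    using vec.subspace_0[OF sub(1)] by force
  have "vec.dim ?S > 2"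
  proof (rule ccontr)
    assume "\<not> vec.dim ?S > 2"
    then have "?S = L"
      using vec.subspace_dim_equal[OF sub(1) S LS] sub by simp
    then have "M \<subseteq> L"
      using MS by simp
    then show False
      using proj_lines_subset_eq[OF assms(2,1)] assms(3) by simp
  qed
  moreover have "vec.dim ?S \<le> 3"
    using dim_subset_UNIV_cart_gen[of ?S] by simp
  ultimately have "vec.dim (L \<inter> M) = 1"
    using vec.dim_sums_Int[OF sub(1,2)] sub by linarith
  then show ?thesis
    using sub by (simp add: proj_point_def vec.subspace_inter)
qed

lemma span_subset_line_iff: "proj_line L \<Longrightarrow> vec.span {v} \<subseteq> L \<longleftrightarrow> v \<in> L"
  using vec.span_minimal[of "{v}" L] vec.span_base[of v "{v}"]
  by (auto simp: proj_line_def)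

section \<open>Orders of vanishing and squares of polynomials\<close>

text \<open>Translation carries the factor t - a to t and leaves a cofactor that is nonzero at 0.
  Intersection multiplicities are recorded as orders at 0; this transfers them to the other affine
  points of a line.\<close>

lemma order_0_pcompose_shift:
  fixes g :: "complex poly"
  assumes "g \<noteq> 0"
  shows "order 0 (pcompose g [:a, 1:]) = order a g"
proof -
  obtain r where r: "g = [:- a, 1:] ^ order a g * r" "\<not> [:- a, 1:] dvd r"
    using order_decomp[OF assms, of a] by blast
  have r0: "poly (pcompose r [:a, 1:]) 0 \<noteq> 0"
    using r(2) by (simp add: poly_pcompose poly_eq_0_iff_dvd)
  have "pcompose ([:- a, 1:] ^ k) [:a, 1:] = [:- 0, 1:] ^ k" for k
    by (induction k) (simp_all only: power_Suc power_0 pcompose_mult pcompose_1, simp add: pcompose_pCons)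
  then have eq: "pcompose g [:a, 1:] = [:- 0, 1:] ^ order a g * pcompose r [:a, 1:]"
    by (subst r(1)) (simp only: pcompose_mult)
  moreover have "[:- 0, 1:] ^ order a g * pcompose r [:a, 1:] \<noteq> 0"
    using r0 by (metis mult_eq_0_iff pCons_eq_0_iff poly_0 power_not_zero one_neq_zero)
  ultimately show ?thesis
    using r0 order_0I[OF r0] by (metis order_mult order_power_n_n add.right_neutral)
qed

text \<open>A nonconstant complex polynomial has a root, here of order at least 2; splitting off the
  square of its linear factor keeps all orders even and lowers the degree.\<close>

lemma even_orders_imp_square:
  fixes g :: "complex poly"
  assumes "g \<noteq> 0" "\<And>a. even (order a g)"
  shows "\<exists>h. g = h\<^sup>2"
  using assms
proof (induction "degree g" arbitrary: g rule: less_induct)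
  case less
  show ?case
  proof (cases "degree g = 0")
    case True
    then obtain c where "g = [:c:]"
      by (auto elim: degree_eq_zeroE)
    then have "g = [:csqrt c:]\<^sup>2"
      using power2_csqrt[of c] by (simp add: power2_eq_square)
    then show ?thesis ..
  next
    case False
    then obtain a where a: "poly g a = 0"
      using fundamental_theorem_of_algebra constant_degree by metis
    then have "order a g \<noteq> 0"
      using less.prems(1) order_root by blast
    then have "order a g \<ge> 2"
      using less.prems(2)[of a] by (metis dvd_imp_le not_gr_zero)
    then obtain r where r: "g = [:- a, 1:]\<^sup>2 * r"
      using order_divides[of a 2 g] by (auto elim: dvdE)
    have r0: "r \<noteq> 0"
      using less.prems(1) r by auto
    define l where "l = [:- a, 1:]"
    have "l \<noteq> 0" by (simp add: l_def)
    then have "order b g = 2 * order b l + order b r" for b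
      unfolding r l_def[symmetric] power2_eq_square using r0 by (simp add: order_mult)
    then have "even (order b r)" for b
      using less.prems(2)[of b] by simp
    moreover have "degree r < degree g"
      using r r0 by (simp add: degree_mult_eq degree_power_eq)
    ultimately obtain h where "r = h\<^sup>2"
      using less.hyps r0 by blast
    then show ?thesis
      using r by (metis power_mult_distrib)
  qed
qed

section \<open>Restriction of a form to a bitangent\<close>

lemma span_pair: "vec.span {p, q} = {x *s p + y *s q |x y. True}" for p q :: "complex ^ 3"
proof -
  have "v \<in> vec.span {p, q} \<longleftrightarrow> (\<exists>x y. v = x *s p + y *s q)" for v
    unfolding vec.span_breakdown_eq[of v p "{q}"] vec.span_singleton
    by (auto simp: image_iff diff_eq_eq add.commute)
  then show ?thesis by blast
qed

lemma span_pair_shift: "vec.span {p + t *s q, q} = vec.span {p, q}" for p q :: "complex ^ 3"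
proof -
  have "x *s (p + t *s q) + y *s q = x *s p + (x * t + y) *s q"
    "x *s p + y *s q = x *s (p + t *s q) + (y - x * t) *s q" for x y
    by (simp_all add: vec3_eq_iff algebra_simps)
  then show ?thesis
    unfolding span_pair by blast
qed

text \<open>The divisor condition ranges over all spanning pairs. Replacing \<open>p\<close> by
  \<open>p + a *s q\<close> keeps the span and moves the base point, so the restriction has even
  order at every \<open>a\<close>, not only at 0.\<close>

lemma bitangent_restriction_square:
  assumes "bitangent F L" "vec.span {p, q} = L"
  obtains h :: "complex poly" where "\<And>t. F (p + t *s q) = (poly h t)\<^sup>2"
proof -
  obtain P P' where "cuts_out_divisor F L
      (\<lambda>R. 2 * (if R = P then 1 else 0) + 2 * (if R = P' then 1 else 0))"
    using assms(1) unfolding bitangent_def by blast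
  then have mult: "\<exists>g. (\<forall>t. poly g t = F (p' + t *s q)) \<and> g \<noteq> 0 \<and> even (order 0 g)"
    if "vec.span {p', q} = L" for p'
    using that unfolding cuts_out_divisor_def meets_with_multiplicity_def
    by (metis (no_types, lifting) dvd_add dvd_triv_left)
  obtain g where g: "\<And>t. poly g t = F (p + t *s q)" "g \<noteq> 0"
    using mult assms(2) by blast
  have "even (order a g)" for a
  proof -
    obtain g' where g': "\<And>t. poly g' t = F (p + a *s q + t *s q)" "even (order 0 g')"
      using mult[of "p + a *s q"] assms(2) span_pair_shift by auto
    have "poly g' t = poly (pcompose g [:a, 1:]) t" for t
      by (simp add: g g' poly_pcompose vec.scale_left_distrib add.assoc)
    then have "g' = pcompose g [:a, 1:]"
      by (simp add: poly_eq_poly_eq_iff[symmetric] fun_eq_iff)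
    then show ?thesis
      using g' order_0_pcompose_shift[OF g(2)] by simp
  qed
  then obtain h where "g = h\<^sup>2"
    using even_orders_imp_square g(2) by blast
  then show ?thesis
    using that[of h] g(1) by (metis poly_power)
qed

lemma quartic_eq_square_coeffs:
  fixes h :: "complex poly"
  assumes "\<And>t. poly [:g0, g1, g2, g3, g4:] t = (poly h t)\<^sup>2"
  obtains A B C where "g0 = A\<^sup>2" "g1 = 2 * A * B" "g2 = B\<^sup>2 + 2 * A * C" "g3 = 2 * B * C" "g4 = C\<^sup>2"
proof -
  have eq: "[:g0, g1, g2, g3, g4:] = h\<^sup>2"
    using assms by (simp add: poly_eq_poly_eq_iff[symmetric] fun_eq_iff)
  have "degree (h\<^sup>2) \<le> 4"
    unfolding eq[symmetric] by (simp add: degree_pCons_le)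
  then have "degree h \<le> 2"
    by (cases "h = 0") (simp_all add: degree_power_eq)
  define A B C where "A = coeff h 0" and "B = coeff h 1" and "C = coeff h 2"
  have "h = [:A, B, C:]"
  proof (rule poly_eqI)
    fix i show "coeff h i = coeff [:A, B, C:] i"
      using \<open>degree h \<le> 2\<close>
      by (auto simp: A_def B_def C_def coeff_pCons numeral_2_eq_2 coeff_eq_0 split: nat.split)
  qed
  then have "[:g0, g1, g2, g3, g4:] = [:A\<^sup>2, 2 * A * B, B\<^sup>2 + 2 * A * C, 2 * B * C, C\<^sup>2:]"
    unfolding eq by (simp add: power2_eq_square algebra_simps)
  then show ?thesis
    using that[of A B C] by simp
qed

lemma order_0_linear:
  fixes x y :: complex
  assumes "x \<noteq> 0 \<or> y \<noteq> 0"
  shows "order 0 [:x, y:] = (if x = 0 then 1 else 0)"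
proof (cases "x = 0")
  case True
  then have "[:x, y:] = smult y ([:- 0, 1:] ^ 1)" by simp
  then show ?thesis
    using True assms order_smult[of y 0 "[:- 0, 1:] ^ 1"] order_power_n_n[of "0 :: complex" 1] by simp
qed (simp add: order_0I)

section \<open>The bitangents of the Dyck quartic\<close>

definition dyck_normals :: "(complex ^ 3) set" where
  "dyck_normals =
     (\<lambda>u. vector [1, u, 0]) ` {u. u ^ 4 = - 1} \<union> (\<lambda>u. vector [1, 0, u]) ` {u. u ^ 4 = - 1} \<union>
     (\<lambda>u. vector [0, 1, u]) ` {u. u ^ 4 = - 1} \<union>
     (\<lambda>(a, b). vector [1, a, b]) ` ({a. a ^ 4 = 1} \<times> {b. b ^ 4 = 1})"

lemma normed_dyck_normals: "n \<in> dyck_normals \<Longrightarrow> normed n"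
  by (auto simp: dyck_normals_def normed_def)

text \<open>These are the coefficient equations for the line x + a y + b z = 0. If \<open>a\<close>
  and \<open>b\<close> are nonzero, the second and fourth equations make \<open>A\<close> and
  \<open>C\<close> the same multiple \<open>k\<close> of a^2 and b^2, and the middle one becomes a
  quadratic equation for k^2.\<close>

lemma line_restriction_square_solve:
  fixes a b A B C :: complex
  assumes "a ^ 4 + 1 = A\<^sup>2" "4 * a ^ 3 * b = 2 * A * B" "6 * a\<^sup>2 * b\<^sup>2 = B\<^sup>2 + 2 * A * C"
    "4 * a * b ^ 3 = 2 * B * C" "b ^ 4 + 1 = C\<^sup>2"
  shows "a = 0 \<and> b ^ 4 = - 1 \<or> b = 0 \<and> a ^ 4 = - 1 \<or> a ^ 4 = 1 \<and> b ^ 4 = 1"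
proof -
  consider "a = 0" | "b = 0" | "a \<noteq> 0" "b \<noteq> 0" by blast
  then show ?thesis
  proof cases
    case 1
    then have "A \<noteq> 0" using assms(1) by auto
    then have "B = 0" "C = 0" using 1 assms by auto
    then show ?thesis using 1 assms by (simp add: eq_neg_iff_add_eq_0)
  next
    case 2
    then have "C \<noteq> 0" using assms by auto
    then have "B = 0" "A = 0" using 2 assms by auto
    then show ?thesis using 2 assms by (simp add: eq_neg_iff_add_eq_0)
  next
    case 3
    have "B \<noteq> 0" using assms 3 by auto
    have "B * (A * b\<^sup>2) = B * (C * a\<^sup>2)"
      using assms(2,4) by algebra
    then have "A * b\<^sup>2 = C * a\<^sup>2" using \<open>B \<noteq> 0\<close> by simp
    define k where "k = A / a\<^sup>2"
    have A: "A = k * a\<^sup>2" and C: "C = k * b\<^sup>2"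
      using 3 \<open>A * b\<^sup>2 = C * a\<^sup>2\<close> by (simp_all add: k_def field_simps)
    have "a\<^sup>2 * (k * B) = a\<^sup>2 * (2 * a * b)"
      using assms(2) A by algebra
    then have kB: "k * B = 2 * a * b" using 3 by simp
    have "a\<^sup>2 * b\<^sup>2 * (6 * k\<^sup>2) = a\<^sup>2 * b\<^sup>2 * (4 + 2 * k ^ 4)"
      using assms(3) A C kB by algebra
    then have "6 * k\<^sup>2 = 4 + 2 * k ^ 4" using 3 by simp
    \<comment> \<open>The root 1 would give a^4 + 1 = a^4; the root 2 gives a^4 = b^4 = 1.\<close>
    then have "(k\<^sup>2 - 1) * (k\<^sup>2 - 2) = 0" by algebra
    then have "k\<^sup>2 = 1 \<or> k\<^sup>2 = 2" by auto
    moreover have "a ^ 4 + 1 = k\<^sup>2 * a ^ 4" "b ^ 4 + 1 = k\<^sup>2 * b ^ 4"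
      using assms(1,5) A C by algebra+
    ultimately show ?thesis by auto
  qed
qed

lemma dyck_bitangent_normal:
  assumes "normed n" "bitangent dyck_form (line_of n)"
  shows "n \<in> dyck_normals"
proof -
  have square: "\<exists>h :: complex poly. \<forall>t. dyck_form (p + t *s q) = (poly h t)\<^sup>2"
    if "vec.span {p, q} = line_of n" for p q
    using bitangent_restriction_square[OF assms(2) that] by metis
  consider a b where "n = vector [1, a, b]" | c where "n = vector [0, 1, c]" | "n = vector [0, 0, 1]"
    using assms(1) unfolding normed_def by (auto simp: vec3_eq_iff)
  then show ?thesis
  proof cases
    case (1 a b)
    \<comment> \<open>On this basis (y, z) = (1, t), and the form becomes (a + b t)^4 + 1 +
      t^4.\<close>
    define p q :: "complex ^ 3" where "p = vector [- a, 1, 0]" and "q = vector [- b, 0, 1]"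
    have "vec.span {p, q} = line_of n"
      unfolding span_pair
      by (auto simp: 1 p_def q_def line_of_def dot3_def vec3_eq_iff eq_neg_iff_add_eq_0 algebra_simps)
    then obtain h :: "complex poly" where h: "\<And>t. dyck_form (p + t *s q) = (poly h t)\<^sup>2"
      using square by blast
    have "poly [:a ^ 4 + 1, 4 * a ^ 3 * b, 6 * a\<^sup>2 * b\<^sup>2, 4 * a * b ^ 3, b ^ 4 + 1:] t = (poly h t)\<^sup>2" for t
      unfolding h[symmetric] by (simp add: dyck_form_def p_def q_def) algebra
    then have "a = 0 \<and> b ^ 4 = - 1 \<or> b = 0 \<and> a ^ 4 = - 1 \<or> a ^ 4 = 1 \<and> b ^ 4 = 1"
      by (rule quartic_eq_square_coeffs) (rule line_restriction_square_solve)
    then show ?thesis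
      by (auto simp: dyck_normals_def 1)
  next
    case (2 c)
    \<comment> \<open>The point (1, -c t, t) gives 1 + (c^4 + 1) t^4; the missing linear and
      quadratic terms force the square root to be constant.\<close>
    define p q :: "complex ^ 3" where "p = vector [1, 0, 0]" and "q = vector [0, - c, 1]"
    have "vec.span {p, q} = line_of n"
      unfolding span_pair
      by (auto simp: 2 p_def q_def line_of_def dot3_def vec3_eq_iff eq_neg_iff_add_eq_0 algebra_simps)
    then obtain h :: "complex poly" where h: "\<And>t. dyck_form (p + t *s q) = (poly h t)\<^sup>2"
      using square by blast
    have "poly [:1, 0, 0, 0, c ^ 4 + 1:] t = (poly h t)\<^sup>2" for t
      unfolding h[symmetric] by (simp add: dyck_form_def p_def q_def) algebra
    then obtain A B C where "1 = A\<^sup>2" "0 = 2 * A * B" "0 = B\<^sup>2 + 2 * A * C" "c ^ 4 + 1 = C\<^sup>2"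
      by (rule quartic_eq_square_coeffs)
    then have "c ^ 4 = - 1"
      by (auto simp: eq_neg_iff_add_eq_0)
    then show ?thesis
      by (auto simp: dyck_normals_def 2)
  next
    case 3
    \<comment> \<open>On z = 0 the form is 1 + t^4, which is not a square, so this line is no
      bitangent.\<close>
    define p q :: "complex ^ 3" where "p = vector [1, 0, 0]" and "q = vector [0, 1, 0]"
    have "vec.span {p, q} = line_of n"
      unfolding span_pair
      by (auto simp: 3 p_def q_def line_of_def dot3_def vec3_eq_iff)
    then obtain h :: "complex poly" where h: "\<And>t. dyck_form (p + t *s q) = (poly h t)\<^sup>2"
      using square by blast
    have "poly [:1, 0, 0, 0, 1:] t = (poly h t)\<^sup>2" for t
      unfolding h[symmetric] by (simp add: dyck_form_def p_def q_def) algebra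
    then obtain A B C :: complex where "1 = A\<^sup>2" "0 = 2 * A * B" "0 = B\<^sup>2 + 2 * A * C" "1 = C\<^sup>2"
      by (rule quartic_eq_square_coeffs)
    then show ?thesis by auto
  qed
qed

text \<open>Each of the two linear forms vanishes at a single point of the line, its normal not
  being parallel to \<open>n\<close>. These zeros are the tangency points; \<open>m\<close> and
  \<open>m'\<close> may coincide, which gives a hyperflex.\<close>

lemma bitangent_if_square:
  assumes n: "n \<noteq> 0" and m: "\<not> parallel m n" "\<not> parallel m' n" and c: "c \<noteq> 0"
    and F: "\<And>v. dot3 n v = 0 \<Longrightarrow> F v = c * (dot3 m v * dot3 m' v)\<^sup>2"
  shows "bitangent F (line_of n)"
proof -
  let ?L = "line_of n"
  have L: "proj_line ?L" using n by (rule proj_line_line_of)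
  \<comment> \<open>Stated for an arbitrary form so as to serve both \<open>m\<close> and
    \<open>m'\<close>. If the form vanishes at \<open>p\<close>, it does not vanish at
    \<open>q\<close>, so its zero along the line is simple.\<close>
  have cut: "proj_point (?L \<inter> line_of m)"
      "vec.span {p, q} = ?L \<Longrightarrow> vec.span {p} = ?L \<inter> line_of m \<longleftrightarrow> dot3 m p = 0"
      "vec.span {p, q} = ?L \<Longrightarrow> dot3 m p = 0 \<Longrightarrow> dot3 m q \<noteq> 0"
    if "\<not> parallel m n" for m p q
  proof -
    have "m \<noteq> 0" using that by (auto simp: parallel_def)
    then have M: "proj_line (line_of m)" by (rule proj_line_line_of)
    have LM: "?L \<noteq> line_of m" using that line_of_eq_parallel by metis
    show PT: "proj_point (?L \<inter> line_of m)"
      using proj_point_Int[OF L M LM] .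
    assume pq: "vec.span {p, q} = ?L"
    have pL: "p \<in> ?L" using vec.span_base[of p "{p, q}"] pq by simp
    show "dot3 m q \<noteq> 0" if "dot3 m p = 0"
    proof
      assume "dot3 m q = 0"
      then have "?L \<subseteq> line_of m"
        unfolding pq[symmetric] using that by (auto simp: span_pair line_of_def dot3_add dot3_scale)
      then show False using proj_lines_subset_eq L M LM by blast
    qed
    have "p \<noteq> 0"
    proof
      assume "p = 0"
      then have "vec.dim ?L \<le> 1"
        unfolding pq[symmetric] using vec.dim_singleton[of q] by simp
      then show False using L by (simp add: proj_line_def)
    qed
    show "vec.span {p} = ?L \<inter> line_of m \<longleftrightarrow> dot3 m p = 0"
    proof
      assume "vec.span {p} = ?L \<inter> line_of m"
      then have "p \<in> line_of m" using vec.span_base[of p "{p}"] by blast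
      then show "dot3 m p = 0" by (simp add: line_of_def)
    next
      assume "dot3 m p = 0"
      then have "vec.span {p} \<subseteq> ?L \<inter> line_of m"
        using pL span_subset_line_iff L M by (simp add: line_of_def)
      then show "vec.span {p} = ?L \<inter> line_of m"
        using proj_points_subset_eq[OF proj_point_span PT] \<open>p \<noteq> 0\<close> by blast
    qed
  qed
  define P P' where "P = ?L \<inter> line_of m" and "P' = ?L \<inter> line_of m'"
  have curve: "P \<in> plane_curve F" "P' \<in> plane_curve F"
    using cut(1) m F by (auto simp: plane_curve_def P_def P'_def line_of_def)
  have "meets_with_multiplicity F p q
      (2 * (if vec.span {p} = P then 1 else 0) + 2 * (if vec.span {p} = P' then 1 else 0))"
    if pq: "vec.span {p, q} = ?L" for p q
  proof -
    \<comment> \<open>The two forms along the line; each has order 1 at t = 0 exactly when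
      \<open>p\<close> spans its tangency point.\<close>
    define l l' where "l = [:dot3 m p, dot3 m q:]" and "l' = [:dot3 m' p, dot3 m' q:]"
    define g where "g = smult c ((l * l')\<^sup>2)"
    have ord: "l \<noteq> 0" "order 0 l = (if vec.span {p} = P then 1 else 0)"
        "l' \<noteq> 0" "order 0 l' = (if vec.span {p} = P' then 1 else 0)"
      using cut(2,3)[OF m(1) pq] cut(2,3)[OF m(2) pq]
      by (auto simp: l_def l'_def P_def P'_def order_0_linear)
    have "dot3 n (p + t *s q) = 0" for t
    proof -
      have "p + t *s q \<in> vec.span {p, q}"
        by (simp add: vec.span_add vec.span_scale vec.span_base)
      then show ?thesis unfolding pq by (simp add: line_of_def)
    qed
    then have "poly g t = F (p + t *s q)" for t
      by (simp add: F g_def l_def l'_def dot3_add dot3_scale algebra_simps)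
    moreover have "g \<noteq> 0"
      using c ord by (simp add: g_def)
    moreover have "order 0 g = 2 * order 0 l + 2 * order 0 l'"
      using c ord by (simp add: g_def order_smult power2_eq_square order_mult)
    ultimately show ?thesis
      unfolding meets_with_multiplicity_def by (intro exI[of _ g]) (simp add: ord(2,4))
  qed
  moreover have "P \<subseteq> ?L" "P' \<subseteq> ?L"
    unfolding P_def P'_def by (rule Int_lower1)+
  ultimately have "cuts_out_divisor F ?L
      (\<lambda>R. 2 * (if R = P then 1 else 0) + 2 * (if R = P' then 1 else 0))"
    unfolding cuts_out_divisor_def by auto
  then show ?thesis
    unfolding bitangent_def using L curve by blast
qed

text \<open>On a hyperflex line two of the three fourth powers cancel, and the form is the fourth
  power of the remaining coordinate.\<close>

lemma bitangent_dyck_normal: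
  assumes "n \<in> dyck_normals"
  shows "bitangent dyck_form (line_of n)"
proof -
  have n0: "n \<noteq> 0" using assms normed_dyck_normals normed_nonzero by blast
  consider u where "n = vector [1, u, 0]" "u ^ 4 = - 1" | u where "n = vector [1, 0, u]" "u ^ 4 = - 1"
    | u where "n = vector [0, 1, u]" "u ^ 4 = - 1"
    | a b where "n = vector [1, a, b]" "a ^ 4 = 1" "b ^ 4 = 1"
    using assms unfolding dyck_normals_def by auto
  then show ?thesis
  proof cases
    case (1 u)
    show ?thesis
    proof (rule bitangent_if_square[of _ "vector [0, 0, 1]" "vector [0, 0, 1]" 1])
      fix v assume "dot3 n v = 0"
      then have "v $ 1 + u * v $ 2 = 0" by (simp add: dot3_def 1)
      then show "dyck_form v = 1 * (dot3 (vector [0, 0, 1]) v * dot3 (vector [0, 0, 1]) v)\<^sup>2"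
        using 1(2) by (simp add: dyck_form_def dot3_def) algebra
    qed (use n0 in \<open>auto simp: 1 parallel_def\<close>)
  next
    case (2 u)
    show ?thesis
    proof (rule bitangent_if_square[of _ "vector [0, 1, 0]" "vector [0, 1, 0]" 1])
      fix v assume "dot3 n v = 0"
      then have "v $ 1 + u * v $ 3 = 0" by (simp add: dot3_def 2)
      then show "dyck_form v = 1 * (dot3 (vector [0, 1, 0]) v * dot3 (vector [0, 1, 0]) v)\<^sup>2"
        using 2(2) by (simp add: dyck_form_def dot3_def) algebra
    qed (use n0 in \<open>auto simp: 2 parallel_def\<close>)
  next
    case (3 u)
    show ?thesis
    proof (rule bitangent_if_square[of _ "vector [1, 0, 0]" "vector [1, 0, 0]" 1])
      fix v assume "dot3 n v = 0"
      then have "v $ 2 + u * v $ 3 = 0" by (simp add: dot3_def 3)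
      then show "dyck_form v = 1 * (dot3 (vector [1, 0, 0]) v * dot3 (vector [1, 0, 0]) v)\<^sup>2"
        using 3(2) by (simp add: dyck_form_def dot3_def) algebra
    qed (use n0 in \<open>auto simp: 3 parallel_def\<close>)
  next
    case (4 a b)
    \<comment> \<open>A primitive cube root of unity: Y^2 + Y Z + Z^2 = (Y - w Z) (Y - w^2 Z), and -
      w^2 = 1 + w gives the second linear form below.\<close>
    define w where "w = (- 1 + csqrt (- 3)) / 2"
    have "(csqrt (- 3))\<^sup>2 = - 3" by (rule power2_csqrt)
    then have w: "w\<^sup>2 + w + 1 = 0"
      by (simp add: w_def power2_eq_square field_simps)
    have "a \<noteq> 0" using 4(2) by auto
    show ?thesis
    proof (rule bitangent_if_square[of _ "vector [0, a, - w * b]" "vector [0, a, (1 + w) * b]" 2])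
      fix v assume "dot3 n v = 0"
      then have "v $ 1 + a * v $ 2 + b * v $ 3 = 0" by (simp add: dot3_def 4)
      then show "dyck_form v = 2 * (dot3 (vector [0, a, - w * b]) v * dot3 (vector [0, a, (1 + w) * b]) v)\<^sup>2"
        using 4(2,3) w by (simp add: dyck_form_def dot3_def) algebra
    qed (use n0 \<open>a \<noteq> 0\<close> in \<open>auto simp: 4 parallel_def\<close>)
  qed
qed

lemma bitangents_eq: "{L. bitangent dyck_form L} = line_of ` dyck_normals"
proof -
  have "L \<in> line_of ` dyck_normals" if "bitangent dyck_form L" for L
  proof -
    obtain n where "normed n" "L = line_of n"
      using \<open>bitangent dyck_form L\<close> proj_line_obtain unfolding bitangent_def by metis
    then show ?thesis
      using that dyck_bitangent_normal by blast
  qed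
  then show ?thesis
    using bitangent_dyck_normal by blast
qed

section \<open>Double counting of pairs of lines\<close>

text \<open>Distinct lines meet in exactly one point, so their ordered pairs are partitioned by the
  meeting point, and a point on k lines receives k (k - 1) of them. Finiteness holds because each
  such point is recovered from a pair.\<close>

lemma sum_multiplicities:
  fixes inc :: "'p \<Rightarrow> 'l \<Rightarrow> bool" and X :: "'p set" and A :: "'l set"
  defines "k \<equiv> \<lambda>P. card {L \<in> A. inc P L}"
  assumes fin: "finite A"
    and meet: "\<And>L M. L \<in> A \<Longrightarrow> M \<in> A \<Longrightarrow> L \<noteq> M \<Longrightarrow> \<exists>!P. P \<in> X \<and> inc P L \<and> inc P M"
  shows "finite {P \<in> X. k P \<ge> 2}"
    and "(\<Sum>P \<in> {P \<in> X. k P \<ge> 2}. k P * (k P - 1)) = card A * (card A - 1)"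
proof -
  define R where "R = {P \<in> X. k P \<ge> 2}"
  define off where "off = (\<lambda>B :: 'l set. SIGMA L:B. B - {L})"
  define through where "through = (\<lambda>P. {L \<in> A. inc P L})"
  have card_off: "card (off B) = card B * (card B - 1)" if "finite B" for B
    using that by (simp add: off_def)
  have fin_off: "finite (off A)"
    using fin by (simp add: off_def)
  have sub: "off (through P) \<subseteq> off A" for P
    by (auto simp: off_def through_def)
  have fin_through: "finite (through P)" for P
    using fin by (simp add: through_def)
  have pair_iff: "p \<in> off (through P) \<longleftrightarrow> p \<in> off A \<and> inc P (fst p) \<and> inc P (snd p)" for p P
    by (auto simp: off_def through_def)
  have meet': "\<exists>!P. P \<in> X \<and> inc P (fst p) \<and> inc P (snd p)" if "p \<in> off A" for p
  proof -
    have "fst p \<in> A" "snd p \<in> A" "fst p \<noteq> snd p"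
      using that by (auto simp: off_def)
    then show ?thesis by (rule meet)
  qed
  \<comment> \<open>The product k (k - 1) is nonzero exactly from k = 2 on, so \<open>R\<close>
    collects the points that receive a pair.\<close>
  have R: "P \<in> R \<longleftrightarrow> P \<in> X \<and> off (through P) \<noteq> {}" for P
  proof -
    have "off (through P) \<noteq> {} \<longleftrightarrow> card (off (through P)) \<noteq> 0"
      using finite_subset[OF sub fin_off] by simp
    also have "\<dots> \<longleftrightarrow> k P \<ge> 2"
      unfolding card_off[OF fin_through] by (auto simp: k_def through_def)
    finally show ?thesis by (simp add: R_def)
  qed
  have "R \<subseteq> (\<lambda>p. THE P. P \<in> X \<and> inc P (fst p) \<and> inc P (snd p)) ` off A"
  proof
    fix P assume "P \<in> R"
    then obtain p where p: "P \<in> X" "p \<in> off A" "inc P (fst p)" "inc P (snd p)"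
      using R pair_iff by blast
    then have the_P: "(THE P. P \<in> X \<and> inc P (fst p) \<and> inc P (snd p)) = P"
      using the1_equality[OF meet'] by blast
    show "P \<in> (\<lambda>p. THE P. P \<in> X \<and> inc P (fst p) \<and> inc P (snd p)) ` off A"
      using the_P[symmetric] p(2) by (rule image_eqI)
  qed
  then have finR: "finite R"
    using fin_off finite_surj by blast
  have "off A = (\<Union>P\<in>R. off (through P))"
  proof
    show "off A \<subseteq> (\<Union>P\<in>R. off (through P))"
    proof
      fix p assume p: "p \<in> off A"
      then obtain P where "P \<in> X" "inc P (fst p)" "inc P (snd p)"
        using meet' by blast
      then show "p \<in> (\<Union>P\<in>R. off (through P))"
        using p R pair_iff by blast
    qed
  qed (use sub in blast)
  moreover have "off (through P) \<inter> off (through Q) = {}" if "P \<in> R" "Q \<in> R" "P \<noteq> Q" for P Q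
  proof -
    have "P \<in> X" "Q \<in> X" using that R by auto
    then show ?thesis using meet' pair_iff that(3) by blast
  qed
  ultimately have "card (off A) = (\<Sum>P\<in>R. card (off (through P)))"
    using finR finite_subset[OF sub fin_off] by (simp add: card_UN_disjoint)
  then have "(\<Sum>P\<in>R. k P * (k P - 1)) = card A * (card A - 1)"
    unfolding card_off[OF fin] card_off[OF fin_through] by (simp add: k_def through_def)
  then show "finite {P \<in> X. k P \<ge> 2}"
    "(\<Sum>P \<in> {P \<in> X. k P \<ge> 2}. k P * (k P - 1)) = card A * (card A - 1)"
    using finR by (simp_all add: R_def)
qed

section \<open>Numbers with zero sum and prescribed fourth powers\<close>

lemma power4_eq_1_cases:
  fixes a :: complex
  assumes "a ^ 4 = 1"
  shows "a = 1 \<or> a = - 1 \<or> a = \<i> \<or> a = - \<i>"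
proof -
  have "\<i> * \<i> = (- 1 :: complex)" by simp
  then have "(a - 1) * (a + 1) * (a - \<i>) * (a + \<i>) = 0"
    using assms by algebra
  then show ?thesis by (auto simp: eq_neg_iff_add_eq_0)
qed

text \<open>If \<open>x\<close> were nonzero, w = y / x would satisfy w^4 = 1 and (1 + w)^4 = -1,
  but for w = 1, -1, i, -i the power (1 + w)^4 is 16, 0, -4, -4.\<close>

lemma collinear_quartic_eq_eq_neg:
  fixes x y z :: complex
  assumes "x + y + z = 0" "y ^ 4 = x ^ 4" "z ^ 4 = - (x ^ 4)"
  shows "x = 0"
proof (rule ccontr)
  assume "x \<noteq> 0"
  define w where "w = y / x"
  have y: "y = w * x" using \<open>x \<noteq> 0\<close> by (simp add: w_def)
  have "x ^ 4 * w ^ 4 = x ^ 4 * 1" using assms(2) y by (simp add: power_mult_distrib)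
  then have w4: "w ^ 4 = 1" using \<open>x \<noteq> 0\<close> by simp
  have "x ^ 4 * (3 + 4 * w + 6 * w\<^sup>2 + 4 * w ^ 3) = 0"
    using assms y by algebra
  then have "3 + 4 * w + 6 * w\<^sup>2 + 4 * w ^ 3 = 0" using \<open>x \<noteq> 0\<close> by simp
  then show False
    using power4_eq_1_cases[OF w4] by (elim disjE) (simp_all add: power3_eq_cube)
qed

text \<open>Both numbers are primitive eighth roots of unity, so \<open>t\<close> is one of s, -s,
  s^3, -s^3. In the last three cases the equality of fourth powers becomes a polynomial equation in
  \<open>s\<close> without common root with s^4 + 1.\<close>

lemma one_plus_power4_inj:
  fixes s t :: complex
  assumes "s ^ 4 = - 1" "t ^ 4 = - 1" "(1 + s) ^ 4 = (1 + t) ^ 4"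
  shows "s = t"
proof -
  have "(t - s) * (t + s) * (t\<^sup>2 + s\<^sup>2) = 0"
    using assms(1,2) by algebra
  moreover have "t\<^sup>2 + s\<^sup>2 \<noteq> 0"
  proof
    assume "t\<^sup>2 + s\<^sup>2 = 0"
    then have "(t - s ^ 3) * (t + s ^ 3) = 0"
      using assms(1) by algebra
    then have "t = s ^ 3 \<or> t = - (s ^ 3)" by (auto simp: eq_neg_iff_add_eq_0)
    then show False
    proof
      assume "t = s ^ 3"
      then have "12 * s\<^sup>2 = 0" using assms by algebra
      then show False using assms(1) by auto
    next
      assume "t = - (s ^ 3)"
      then have "8 * s + 12 * s\<^sup>2 + 8 * s ^ 3 = 0" using assms by algebra
      then have "s * (2 + 3 * s + 2 * s\<^sup>2) = 0" by algebra
      then have "2 + 3 * s + 2 * s\<^sup>2 = 0" using assms(1) by auto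
      then have "(1 :: complex) = 0" using assms(1) by algebra
      then show False by simp
    qed
  qed
  moreover have "t + s \<noteq> 0"
  proof
    assume "t + s = 0"
    then have "8 * s * (1 + s\<^sup>2) = 0" using assms by algebra
    then have "s = 0 \<or> s\<^sup>2 = - 1" by (auto simp: eq_neg_iff_add_eq_0 add.commute)
    then show False
    proof
      assume "s\<^sup>2 = - 1"
      then have "(2 :: complex) = 0" using assms(1) by algebra
      then show False by simp
    qed (use assms(1) in simp)
  qed
  ultimately show ?thesis by simp
qed

text \<open>The ratios y / x and y' / x' are fourth roots of -1, and adding 1 to either gives a
  number with fourth power z^4 / x^4, so \<open>one_plus_power4_inj\<close> makes them
  equal.\<close>

lemma collinear_quartic_unique:
  fixes x y z :: complex
  assumes "x + y + z = 0" "x' + y' + z' = 0" "x \<noteq> 0" "y ^ 4 = - (x ^ 4)"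
    and "x' ^ 4 = x ^ 4" "y' ^ 4 = y ^ 4" "z' ^ 4 = z ^ 4"
  shows "x * y' = x' * y"
proof -
  have x': "x' \<noteq> 0" using assms by auto
  have "y / x = y' / x'"
  proof (rule one_plus_power4_inj)
    show "(y / x) ^ 4 = - 1" "(y' / x') ^ 4 = - 1"
      using assms x' by (simp_all add: power_divide)
    have "x + y = - z" "x' + y' = - z'"
      using assms(1,2) by (simp_all add: eq_neg_iff_add_eq_0)
    then have "1 + y / x = - z / x" "1 + y' / x' = - z' / x'"
      using assms(3) x' by (metis add_divide_distrib divide_self)+
    then show "(1 + y / x) ^ 4 = (1 + y' / x') ^ 4"
      using assms by (simp add: power_divide)
  qed
  then show ?thesis using assms(3) x' by (simp add: field_simps)
qed

text \<open>The difference of the two quartics is a cubic in \<open>y\<close>; if all its roots were common, it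
  would divide \<open>y\<^sup>4 - c\<close>, which the vanishing \<open>y\<^sup>2\<close>- and \<open>y\<^sup>3\<close>-coefficients forbid.
  The proof runs this through divided differences.\<close>

lemma no_three_common_quartic_roots:
  fixes x :: complex
  assumes "x \<noteq> 0" "y1 \<noteq> y2" "y1 \<noteq> y3" "y2 \<noteq> y3"
    and y: "y1 ^ 4 = c" "y2 ^ 4 = c" "y3 ^ 4 = c"
    and xy: "(x + y1) ^ 4 = d" "(x + y2) ^ 4 = d" "(x + y3) ^ 4 = d"
  shows False
proof -
  have cubic: "2 * x\<^sup>2 + 3 * x * (s + t) + 2 * (s\<^sup>2 + s * t + t\<^sup>2) = 0"
    and quart: "s ^ 3 + s\<^sup>2 * t + s * t\<^sup>2 + t ^ 3 = 0"
    if "s \<noteq> t" "s ^ 4 = c" "t ^ 4 = c" "(x + s) ^ 4 = d" "(x + t) ^ 4 = d" for s t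
  proof -
    have "(2 * x * (s - t)) * (2 * x\<^sup>2 + 3 * x * (s + t) + 2 * (s\<^sup>2 + s * t + t\<^sup>2)) =
        ((x + s) ^ 4 - (x + t) ^ 4) - (s ^ 4 - t ^ 4)"
      by algebra
    also have "\<dots> = 0"
      using that by simp
    finally have "(2 * x * (s - t)) * (2 * x\<^sup>2 + 3 * x * (s + t) + 2 * (s\<^sup>2 + s * t + t\<^sup>2)) = 0" .
    moreover have "2 * x * (s - t) \<noteq> 0"
      using that(1) assms(1) by simp
    ultimately show "2 * x\<^sup>2 + 3 * x * (s + t) + 2 * (s\<^sup>2 + s * t + t\<^sup>2) = 0"
      using mult_eq_0_iff by blast
    have "(s - t) * (s ^ 3 + s\<^sup>2 * t + s * t\<^sup>2 + t ^ 3) = s ^ 4 - t ^ 4"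
      by algebra
    then have "(s - t) * (s ^ 3 + s\<^sup>2 * t + s * t\<^sup>2 + t ^ 3) = 0"
      using that(2,3) by simp
    then show "s ^ 3 + s\<^sup>2 * t + s * t\<^sup>2 + t ^ 3 = 0"
      using that(1) by simp
  qed
  have c12: "2 * x\<^sup>2 + 3 * x * (y1 + y2) + 2 * (y1\<^sup>2 + y1 * y2 + y2\<^sup>2) = 0"
    and c13: "2 * x\<^sup>2 + 3 * x * (y1 + y3) + 2 * (y1\<^sup>2 + y1 * y3 + y3\<^sup>2) = 0"
    using cubic y xy assms(2,3) by blast+
  have q12: "y1 ^ 3 + y1\<^sup>2 * y2 + y1 * y2\<^sup>2 + y2 ^ 3 = 0"
    and q13: "y1 ^ 3 + y1\<^sup>2 * y3 + y1 * y3\<^sup>2 + y3 ^ 3 = 0"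
    using quart y xy assms(2,3) by blast+
  \<comment> \<open>Second divided differences: subtracting the relations for the two pairs leaves a
    multiple of \<open>y2 - y3\<close>.\<close>
  have "(y2 - y3) * (3 * x + 2 * (y1 + y2 + y3)) = 0"
    using c12 c13 by algebra
  then have e1: "3 * x + 2 * (y1 + y2 + y3) = 0" using assms(4) by simp
  have "(y2 - y3) * (y1\<^sup>2 + y2\<^sup>2 + y3\<^sup>2 + y1 * y2 + y1 * y3 + y2 * y3) = 0"
    using q12 q13 by algebra
  then have h2: "y1\<^sup>2 + y2\<^sup>2 + y3\<^sup>2 + y1 * y2 + y1 * y3 + y2 * y3 = 0" using assms(4) by simp
  \<comment> \<open>Put S = y1 + y2 + y3. Modulo \<open>e1\<close>, subtracting twice
    \<open>h2\<close> from \<open>c12\<close> leaves 2 x^2 = 2 S^2, while \<open>e1\<close> says S =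
    -3 x / 2.\<close>
  have "5 * x\<^sup>2 = 0" using e1 h2 c12 by algebra
  then show False using assms(1) by simp
qed

section \<open>Counting the bitangents through a point\<close>

text \<open>By symmetry one function of two coordinates serves all three pencils of hyperflex
  lines.\<close>

definition flex_count :: "complex \<Rightarrow> complex \<Rightarrow> nat" where
  "flex_count x y = card {u. u ^ 4 = - 1 \<and> x + u * y = 0}"

text \<open>Indexes the ordinary bitangents, those of the form \<open>x + a y + b z = 0\<close>, through a point.\<close>

definition ord_pairs :: "complex \<Rightarrow> complex \<Rightarrow> complex \<Rightarrow> (complex \<times> complex) set" where
  "ord_pairs x y z = {(a, b). a ^ 4 = 1 \<and> b ^ 4 = 1 \<and> x + a * y + b * z = 0}"

lemma card_quartic_roots: "c \<noteq> 0 \<Longrightarrow> card {u :: complex. u ^ 4 = c} = 4"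
  by (rule card_nth_roots) simp_all

lemma finite_quartic_roots: "c \<noteq> 0 \<Longrightarrow> finite {u :: complex. u ^ 4 = c}"
  by (rule card_ge_0_finite) (simp add: card_quartic_roots)

lemma card_scaled_root:
  fixes x y c :: complex
  assumes "x \<noteq> 0 \<or> y \<noteq> 0" "c \<noteq> 0"
  shows "card {u. u ^ 4 = c \<and> x + u * y = 0} = (if x ^ 4 = c * y ^ 4 then 1 else 0)"
proof (cases "y = 0")
  case True
  then show ?thesis using assms by simp
next
  case False
  then have "x + u * y = 0 \<longleftrightarrow> u = - x / y" for u
    by (auto simp: field_simps eq_neg_iff_add_eq_0 add.commute)
  then have "{u. u ^ 4 = c \<and> x + u * y = 0} = (if (- x / y) ^ 4 = c then {- x / y} else {})"
    by auto
  also have "(- x / y) ^ 4 = c \<longleftrightarrow> x ^ 4 = c * y ^ 4"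
    using False by (simp add: power_divide field_simps)
  finally show ?thesis by simp
qed

lemma flex_count_0: "flex_count 0 0 = 4"
  by (simp add: flex_count_def card_quartic_roots)

lemma flex_count_eq:
  "x \<noteq> 0 \<or> y \<noteq> 0 \<Longrightarrow> flex_count x y = (if x ^ 4 = - (y ^ 4) then 1 else 0)"
  unfolding flex_count_def using card_scaled_root[of x y "- 1"] by simp

lemma finite_ord_pairs: "finite (ord_pairs x y z)"
  by (rule finite_subset[of _ "{a. a ^ 4 = 1} \<times> {b. b ^ 4 = 1}"])
    (auto simp: ord_pairs_def finite_quartic_roots)

lemma card_ord_pairs_0_right:
  assumes "x \<noteq> 0 \<or> y \<noteq> 0"
  shows "card (ord_pairs x y 0) = (if x ^ 4 = y ^ 4 then 4 else 0)"
proof -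
  have "ord_pairs x y 0 = {a. a ^ 4 = 1 \<and> x + a * y = 0} \<times> {b. b ^ 4 = 1}"
    by (auto simp: ord_pairs_def)
  then show ?thesis
    using card_scaled_root[OF assms, of 1] by (simp add: card_cartesian_product card_quartic_roots)
qed

lemma card_ord_pairs_0_middle:
  assumes "x \<noteq> 0 \<or> z \<noteq> 0"
  shows "card (ord_pairs x 0 z) = (if x ^ 4 = z ^ 4 then 4 else 0)"
proof -
  have "ord_pairs x 0 z = {a. a ^ 4 = 1} \<times> {b. b ^ 4 = 1 \<and> x + b * z = 0}"
    by (auto simp: ord_pairs_def)
  then show ?thesis
    using card_scaled_root[OF assms, of 1] by (simp add: card_cartesian_product card_quartic_roots)
qed

text \<open>Each fourth root of unity \<open>a\<close> determines \<open>b\<close>, so the solutions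
  form a graph; when the second or third coordinate vanishes they form a product instead.\<close>

lemma card_ord_pairs_0_left:
  assumes "z \<noteq> 0"
  shows "card (ord_pairs 0 y z) = (if y ^ 4 = z ^ 4 then 4 else 0)"
proof -
  have "a * y + b * z = 0 \<longleftrightarrow> b = - (a * y / z)" for a b
    using assms by (auto simp: field_simps eq_neg_iff_add_eq_0 add.commute)
  then have "ord_pairs 0 y z = {(a, b). a ^ 4 = 1 \<and> y ^ 4 = z ^ 4 \<and> b = - (a * y / z)}"
    using assms by (auto simp: ord_pairs_def power_divide power_mult_distrib)
  also have "\<dots> = (if y ^ 4 = z ^ 4 then (\<lambda>a. (a, - (a * y / z))) ` {a. a ^ 4 = 1} else {})"
    by auto
  finally show ?thesis
    by (simp add: card_image inj_on_def card_quartic_roots)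
qed

text \<open>For a solution (a, b) the number Y = a y satisfies Y^4 = y^4 and (x + Y)^4 = z^4, and it
  determines the pair; \<open>no_three_common_quartic_roots\<close> excludes three such
  numbers.\<close>

lemma card_ord_pairs_le_2:
  assumes "x \<noteq> 0" "y \<noteq> 0" "z \<noteq> 0"
  shows "card (ord_pairs x y z) \<le> 2"
proof (rule ccontr)
  assume "\<not> card (ord_pairs x y z) \<le> 2"
  then obtain S where "S \<subseteq> ord_pairs x y z" "card S = 3"
    using obtain_subset_with_card_n[of 3 "ord_pairs x y z"] by auto
  then obtain p1 p2 p3 where p: "p1 \<in> ord_pairs x y z" "p2 \<in> ord_pairs x y z" "p3 \<in> ord_pairs x y z"
      "p1 \<noteq> p2" "p1 \<noteq> p3" "p2 \<noteq> p3"
    by (auto simp: card_3_iff)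
  have pt: "(fst p * y) ^ 4 = y ^ 4" "(x + fst p * y) ^ 4 = z ^ 4" if "p \<in> ord_pairs x y z" for p
  proof -
    have "x + fst p * y = - (snd p * z)"
      using that by (auto simp: ord_pairs_def eq_neg_iff_add_eq_0)
    then show "(fst p * y) ^ 4 = y ^ 4" "(x + fst p * y) ^ 4 = z ^ 4"
      using that by (auto simp: ord_pairs_def power_mult_distrib)
  qed
  have inj: "fst p * y \<noteq> fst q * y"
    if "p \<in> ord_pairs x y z" "q \<in> ord_pairs x y z" "p \<noteq> q" for p q
  proof
    assume "fst p * y = fst q * y"
    then have "fst p = fst q" using assms by simp
    moreover have "(fst p - fst q) * y + (snd p - snd q) * z = 0"
      using that(1,2) unfolding ord_pairs_def case_prod_unfold mem_Collect_eq by algebra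
    ultimately show False using that(3) assms by (simp add: prod_eq_iff)
  qed
  show False
    using no_three_common_quartic_roots[of x "fst p1 * y" "fst p2 * y" "fst p3 * y" "y ^ 4" "z ^ 4"]
      assms p inj pt by blast
qed

text \<open>The last hypothesis places the point on a hyperflex line. Then
  \<open>collinear_quartic_unique\<close>, applied to the two coordinates concerned, identifies one
  entry of any two solutions, and the line equations identify the other.\<close>

lemma card_ord_pairs_le_1:
  assumes "x \<noteq> 0" "y \<noteq> 0" "z \<noteq> 0"
    and "y ^ 4 = - (x ^ 4) \<or> z ^ 4 = - (x ^ 4) \<or> z ^ 4 = - (y ^ 4)"
  shows "card (ord_pairs x y z) \<le> 1"
proof -
  have "p = q" if pq: "p \<in> ord_pairs x y z" "q \<in> ord_pairs x y z" for p q
  proof -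
    obtain a b a' b' where p: "p = (a, b)" and q: "q = (a', b')"
      by (cases p, cases q)
    have pw: "(a * y) ^ 4 = y ^ 4" "(b * z) ^ 4 = z ^ 4" "(a' * y) ^ 4 = y ^ 4" "(b' * z) ^ 4 = z ^ 4"
      using pq by (simp_all add: ord_pairs_def p q power_mult_distrib)
    have eq: "x + a * y + b * z = 0" "x + a' * y + b' * z = 0"
      using pq by (simp_all add: ord_pairs_def p q)
    have nz: "a \<noteq> 0" "b \<noteq> 0" "a' \<noteq> 0" "b' \<noteq> 0"
      using pq by (auto simp: ord_pairs_def p q)
    have "a = a' \<or> b = b'"
      using assms(4)
    proof (elim disjE)
      assume "y ^ 4 = - (x ^ 4)"
      then have "x * (a' * y) = x * (a * y)"
        using eq assms(1) pw by (intro collinear_quartic_unique[where z = "b * z" and z' = "b' * z"]) auto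
      then show ?thesis using assms by simp
    next
      assume "z ^ 4 = - (x ^ 4)"
      then have "x * (b' * z) = x * (b * z)"
        using eq assms(1) pw
        by (intro collinear_quartic_unique[where z = "a * y" and z' = "a' * y"]) (auto simp: ac_simps)
      then show ?thesis using assms by simp
    next
      \<comment> \<open>Here only the ratio a : b is determined at first; eliminating
        \<open>z\<close> from the two line equations then gives a = a'.\<close>
      assume "z ^ 4 = - (y ^ 4)"
      then have "a * y * (b' * z) = a' * y * (b * z)"
        using eq assms(2) nz pw
        by (intro collinear_quartic_unique[where z = x and z' = x]) (auto simp: ac_simps)
      then have "a * b' = a' * b" using assms by simp
      then have "(a - a') * x = 0" using eq by algebra
      then show ?thesis using assms by simp
    qed
    moreover have "(a - a') * y + (b - b') * z = 0" using eq by algebra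
    ultimately show "p = q" using assms by (auto simp: p q)
  qed
  then show ?thesis
    using card_le_Suc0_iff_eq[OF finite_ord_pairs] by simp
qed

text \<open>Each alternative places the point on two hyperflex lines: two of the fourth powers agree
  and the third is their negative. Up to the order of the summands this is the situation of
  \<open>collinear_quartic_eq_eq_neg\<close>.\<close>

lemma ord_pairs_empty:
  assumes "x \<noteq> 0"
    and "y ^ 4 = x ^ 4 \<and> z ^ 4 = - (x ^ 4) \<or> z ^ 4 = x ^ 4 \<and> y ^ 4 = - (x ^ 4)
      \<or> y ^ 4 = - (x ^ 4) \<and> z ^ 4 = - (x ^ 4)"
  shows "ord_pairs x y z = {}"
proof -
  have False if ab: "(a, b) \<in> ord_pairs x y z" for a b
  proof -
    have pw: "(a * y) ^ 4 = y ^ 4" "(b * z) ^ 4 = z ^ 4"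
      and eq: "x + a * y + b * z = 0" "x + b * z + a * y = 0" "a * y + b * z + x = 0"
      using ab by (simp_all add: ord_pairs_def power_mult_distrib ac_simps)
    show False
      using assms(2)
    proof (elim disjE conjE)
      assume "y ^ 4 = x ^ 4" "z ^ 4 = - (x ^ 4)"
      then show False
        using collinear_quartic_eq_eq_neg[OF eq(1)] pw assms(1) by simp
    next
      assume "z ^ 4 = x ^ 4" "y ^ 4 = - (x ^ 4)"
      then show False
        using collinear_quartic_eq_eq_neg[OF eq(2)] pw assms(1) by simp
    next
      assume yz: "y ^ 4 = - (x ^ 4)" "z ^ 4 = - (x ^ 4)"
      have "a * y = 0"
        by (rule collinear_quartic_eq_eq_neg[OF eq(3)]) (simp_all only: pw yz minus_minus)
      then have "(a * y) ^ 4 = 0" by simp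
      then have "y ^ 4 = 0" by (simp only: pw)
      then show False using yz(1) assms(1) by simp
    qed
  qed
  then show ?thesis by auto
qed

definition quad_points :: "(complex ^ 3) set" where
  "quad_points =
     {vector [1, 0, 0], vector [0, 1, 0], vector [0, 0, 1]} \<union>
     (\<lambda>u. vector [1, u, 0]) ` {u. u ^ 4 = 1} \<union> (\<lambda>u. vector [1, 0, u]) ` {u. u ^ 4 = 1} \<union>
     (\<lambda>u. vector [0, 1, u]) ` {u. u ^ 4 = 1}"

lemma card_images:
  shows "card ((\<lambda>u. vector [1, u, 0] :: complex ^ 3) ` S) = card S"
    and "card ((\<lambda>u. vector [1, 0, u] :: complex ^ 3) ` S) = card S"
    and "card ((\<lambda>u. vector [0, 1, u] :: complex ^ 3) ` S) = card S"
    and "card ((\<lambda>(a, b). vector [1, a, b] :: complex ^ 3) ` T) = card T"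
  by (auto intro!: card_image simp: inj_on_def vec3_eq_iff)

text \<open>The positions of the zero coordinates keep the four families of normals
  disjoint.\<close>

lemma card_normals_through:
  "card {n \<in> dyck_normals. dot3 n v = 0} =
     flex_count (v $ 1) (v $ 2) + flex_count (v $ 1) (v $ 3) + flex_count (v $ 2) (v $ 3) +
     card (ord_pairs (v $ 1) (v $ 2) (v $ 3))"
proof -
  let ?U = "\<lambda>x y. {u :: complex. u ^ 4 = - 1 \<and> x + u * y = 0}"
  let ?A = "(\<lambda>u. vector [1, u, 0] :: complex ^ 3) ` ?U (v $ 1) (v $ 2)"
  let ?B = "(\<lambda>u. vector [1, 0, u] :: complex ^ 3) ` ?U (v $ 1) (v $ 3)"
  let ?C = "(\<lambda>u. vector [0, 1, u] :: complex ^ 3) ` ?U (v $ 2) (v $ 3)"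
  let ?D = "(\<lambda>(a, b). vector [1, a, b] :: complex ^ 3) ` ord_pairs (v $ 1) (v $ 2) (v $ 3)"
  have "{n \<in> dyck_normals. dot3 n v = 0} = ((?A \<union> ?B) \<union> ?C) \<union> ?D"
    by (auto simp: dyck_normals_def dot3_def ord_pairs_def)
  moreover have fin: "finite (?U x y)" for x y
    using finite_quartic_roots[of "- 1"] by simp
  moreover have "?A \<inter> ?B = {}" "(?A \<union> ?B) \<inter> ?C = {}" "((?A \<union> ?B) \<union> ?C) \<inter> ?D = {}"
    by (auto simp: vec3_eq_iff ord_pairs_def)
  ultimately show ?thesis
    using finite_ord_pairs by (simp add: card_Un_disjoint card_images flex_count_def)
qed

lemma card_dyck_normals: "card dyck_normals = 28"
proof -
  \<comment> \<open>Every normal annihilates the zero vector, so the incidence count at \<open>0\<close> is the total.\<close>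
  have "card {n \<in> dyck_normals. dot3 n 0 = 0} = 12 + card (ord_pairs 0 0 0)"
    by (simp add: card_normals_through flex_count_0)
  moreover have "ord_pairs 0 0 0 = {a. a ^ 4 = 1} \<times> {b. b ^ 4 = 1}"
    by (auto simp: ord_pairs_def)
  ultimately show ?thesis
    by (simp add: dot3_def card_cartesian_product card_quartic_roots)
qed

lemma card_quad_points: "card quad_points = 15"
proof -
  let ?U = "{u :: complex. u ^ 4 = 1}"
  let ?A = "(\<lambda>u. vector [1, u, 0] :: complex ^ 3) ` ?U"
  let ?B = "(\<lambda>u. vector [1, 0, u] :: complex ^ 3) ` ?U"
  let ?C = "(\<lambda>u. vector [0, 1, u] :: complex ^ 3) ` ?U"
  define E :: "(complex ^ 3) set" where
    "E = {vector [1, 0, 0], vector [0, 1, 0], vector [0, 0, 1]}"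
  have "card E = 3" "finite E"
    by (simp_all add: E_def vec3_eq_iff)
  moreover have "E \<inter> ?A = {}" "(E \<union> ?A) \<inter> ?B = {}" "((E \<union> ?A) \<union> ?B) \<inter> ?C = {}"
    by (auto simp: E_def vec3_eq_iff)
  ultimately show ?thesis
    unfolding quad_points_def E_def[symmetric]
    by (simp add: card_Un_disjoint card_images card_quartic_roots finite_quartic_roots)
qed

lemma normed_quad_points: "v \<in> quad_points \<Longrightarrow> normed v"
  by (auto simp: quad_points_def normed_def)

text \<open>The four lines through a vertex of the triangle are all hyperflex lines; those through
  each of the other twelve points are all ordinary bitangents.\<close>

lemma card_normals_through_quad_point:
  assumes "v \<in> quad_points"
  shows "card {n \<in> dyck_normals. dot3 n v = 0} = 4"
proof -
  have nz: "u \<noteq> 0" if "u ^ 4 = 1" for u :: complex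
    using that by auto
  consider "v = vector [1, 0, 0]" | "v = vector [0, 1, 0]" | "v = vector [0, 0, 1]"
    | u where "v = vector [1, u, 0]" "u ^ 4 = 1" | u where "v = vector [1, 0, u]" "u ^ 4 = 1"
    | u where "v = vector [0, 1, u]" "u ^ 4 = 1"
    using assms unfolding quad_points_def by auto
  then show ?thesis
    by cases (simp_all add: card_normals_through nz flex_count_0 flex_count_eq
        card_ord_pairs_0_right card_ord_pairs_0_middle card_ord_pairs_0_left)
qed

lemma card_normals_through_le_2:
  assumes "normed v" "v \<notin> quad_points"
  shows "card {n \<in> dyck_normals. dot3 n v = 0} \<le> 2"
proof -
  consider a b where "v = vector [1, a, b]" "a \<noteq> 0" "b \<noteq> 0"
    | a where "v = vector [1, a, 0]" "a \<noteq> 0" "a ^ 4 \<noteq> 1"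
    | b where "v = vector [1, 0, b]" "b \<noteq> 0" "b ^ 4 \<noteq> 1"
    | c where "v = vector [0, 1, c]" "c \<noteq> 0" "c ^ 4 \<noteq> 1"
  proof -
    have "v = vector [1, v $ 2, v $ 3] \<or> v = vector [0, 1, v $ 3] \<or> v = vector [0, 0, 1]"
      using assms(1) unfolding normed_def by (auto simp: vec3_eq_iff)
    moreover have "vector [1, a, 0] \<in> quad_points" "vector [1, 0, a] \<in> quad_points"
        "vector [0, 1, a] \<in> quad_points" if "a = 0 \<or> a ^ 4 = 1" for a
      using that by (auto simp: quad_points_def)
    moreover have "vector [0, 0, 1] \<in> quad_points"
      by (simp add: quad_points_def)
    ultimately show ?thesis
      using assms(2) that by metis
  qed
  then show ?thesis
  proof cases
    case (1 a b)
    \<comment> \<open>At most two of the three hyperflex relations hold at once. With none, one or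
      two of them there are at most 2, 1 or 0 ordinary bitangents, so the total stays within
      2.\<close>
    have "card (ord_pairs 1 a b) \<le> 2"
      using 1 by (simp add: card_ord_pairs_le_2)
    moreover have "card (ord_pairs 1 a b) \<le> 1" if "a ^ 4 = - 1 \<or> b ^ 4 = - 1 \<or> b ^ 4 = - (a ^ 4)"
      using 1 that card_ord_pairs_le_1[of 1 a b] by simp
    moreover have "ord_pairs 1 a b = {}"
      if "a ^ 4 = 1 \<and> b ^ 4 = - 1 \<or> b ^ 4 = 1 \<and> a ^ 4 = - 1 \<or> a ^ 4 = - 1 \<and> b ^ 4 = - 1"
      using that ord_pairs_empty[of 1 a b] by simp
    ultimately show ?thesis
      using 1 by (auto simp: card_normals_through flex_count_eq minus_equation_iff)
  next
    \<comment> \<open>One coordinate is zero and the other two have different fourth powers: no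
      ordinary bitangent and at most one hyperflex line passes through. The remaining cases are
      alike.\<close>
    case (2 a)
    then show ?thesis
      by (auto simp: card_normals_through flex_count_eq card_ord_pairs_0_right)
  next
    case (3 b)
    then show ?thesis
      by (auto simp: card_normals_through flex_count_eq card_ord_pairs_0_middle)
  next
    case (4 c)
    then show ?thesis
      by (auto simp: card_normals_through flex_count_eq card_ord_pairs_0_left)
  qed
qed

section \<open>Numbers of double and quadruple points\<close>

theorem proposition3p2:
  fixes A :: "(complex ^ 3) set set"
  defines "A \<equiv> {L. bitangent dyck_form L}"
  shows "card A = 28
    \<and> card {P. multiple_point A 2 P} = 288
    \<and> card {P. multiple_point A 4 P} = 15
    \<and> (\<forall>L1\<in>A. \<forall>L2\<in>A. \<forall>P. L1 \<noteq> L2 \<and> proj_point P \<and> P \<subseteq> L1 \<and> P \<subseteq> L2 \<longrightarrow>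
          multiple_point A 2 P \<or> multiple_point A 4 P)"
proof -
  have A: "A = line_of ` dyck_normals"
    by (simp add: A_def bitangents_eq)
  have inj: "inj_on line_of dyck_normals"
    using normed_dyck_normals line_of_eq_parallel normed_parallel_eq by (metis inj_onI)
  have card_A: "card A = 28"
    by (simp add: A card_image inj card_dyck_normals)
  then have fin: "finite A"
    by (simp add: card_ge_0_finite)
  have line: "proj_line L" if "L \<in> A" for L
    using that by (simp add: A_def bitangent_def)
  define k where "k = (\<lambda>P. card {L \<in> A. P \<subseteq> L})"
  have mp: "multiple_point A m P \<longleftrightarrow> proj_point P \<and> k P = m" for m P
    using fin by (simp add: multiple_point_def k_def)
  have k_span: "k (vec.span {v}) = card {n \<in> dyck_normals. dot3 n v = 0}" for v
  proof -
    have "{L \<in> A. vec.span {v} \<subseteq> L} = line_of ` {n \<in> dyck_normals. dot3 n v = 0}"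
      using span_subset_line_iff line by (auto simp: A line_of_def)
    then show ?thesis
      unfolding k_def using inj by (simp add: card_image inj_on_subset)
  qed
  have k4: "k (vec.span {v}) = 4" if "v \<in> quad_points" for v
    using that by (simp add: k_span card_normals_through_quad_point)
  have kP: "P \<in> (\<lambda>v. vec.span {v}) ` quad_points \<or> k P \<le> 2" if "proj_point P" for P
  proof -
    obtain v where "normed v" "P = vec.span {v}"
      using proj_point_obtain \<open>proj_point P\<close> .
    then show ?thesis
      using card_normals_through_le_2[of v] k_span[of v] by (cases "v \<in> quad_points") auto
  qed
  have quad: "{P. multiple_point A 4 P} = (\<lambda>v. vec.span {v}) ` quad_points"
    using kP k4 normed_quad_points normed_nonzero proj_point_span by (fastforce simp: mp)
  moreover have "inj_on (\<lambda>v. vec.span {v}) quad_points"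
    using normed_quad_points span_eq_parallel normed_parallel_eq by (metis (no_types, lifting) inj_onI)
  ultimately have card_quad: "card {P. multiple_point A 4 P} = 15"
    by (simp add: card_image card_quad_points)
  \<comment> \<open>All points on at least two lines; \<open>kP\<close> and \<open>k4\<close> leave
    only the multiplicities 2 and 4.\<close>
  let ?R = "{P \<in> Collect proj_point. k P \<ge> 2}"
  have R: "?R = {P. multiple_point A 2 P} \<union> {P. multiple_point A 4 P}"
    using kP k4 by (fastforce simp: mp)
  have meet: "\<exists>!P. P \<in> Collect proj_point \<and> P \<subseteq> L \<and> P \<subseteq> M"
    if "L \<in> A" "M \<in> A" "L \<noteq> M" for L M
  proof -
    have pt: "proj_point (L \<inter> M)"
      using that line proj_point_Int by blast
    show ?thesis
    proof (rule ex1I[of _ "L \<inter> M"])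
      show "P = L \<inter> M" if "P \<in> Collect proj_point \<and> P \<subseteq> L \<and> P \<subseteq> M" for P
        using that proj_points_subset_eq[OF _ pt, of P] by simp
    qed (use pt in simp)
  qed
  have finR: "finite ?R" and sum: "(\<Sum>P\<in>?R. k P * (k P - 1)) = 28 * 27"
    using sum_multiplicities[OF fin meet] card_A unfolding k_def by auto
  have "(\<Sum>P\<in>?R. k P * (k P - 1)) =
      (\<Sum>P | multiple_point A 2 P. k P * (k P - 1)) + (\<Sum>P | multiple_point A 4 P. k P * (k P - 1))"
    using finR unfolding R by (intro sum.union_disjoint) (auto simp: mp)
  \<comment> \<open>A double point carries 2 * 1 ordered pairs and a quadruple point 4 * 3, so the
    number of double points is (756 - 12 * 15) / 2 = 288.\<close>
  also have "\<dots> = 2 * card {P. multiple_point A 2 P} + 12 * card {P. multiple_point A 4 P}"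
    by (simp add: mp)
  finally have "card {P. multiple_point A 2 P} = 288"
    using sum card_quad by simp
  moreover have "multiple_point A 2 P \<or> multiple_point A 4 P"
    if "L \<in> A" "M \<in> A" "L \<noteq> M" "proj_point P" "P \<subseteq> L" "P \<subseteq> M" for L M P
  proof -
    have "card {L, M} \<le> k P"
      unfolding k_def using that fin by (intro card_mono) auto
    then have "P \<in> ?R" using that by simp
    then show ?thesis unfolding R by blast
  qed
  ultimately show ?thesis
    using card_A card_quad by blast
qed

end
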